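(* Let $G=(V,E)$ be a connected graph with $E(G)\ne\varnothing$. The following two statements are equivalent. (i) For every strictly positive pseudoultrametrizable weight $w:E(G)\to\mathbb{R}^+$ the subdominant pseudoultrametric $\rho_w$ is an ultrametric. (ii) For every pair of distinct points $u^*,v^*\in V(G)$ and for an arbitrary sequence of paths $F_j\in\mathfrak{P}_{u^*,v^*}$, $j\in\mathbb{N}$, there exists an edge $e^0=\{u^0,v^0\}\in E(G)$ such that $$u^0,v^0\in\bigcup_{k=1}^{\infty}V(F_{i+k})\quad\text{for every } i>0.$$
   Context: A graph $G=(V(G),E(G))$ has a nonempty (possibly infinite) vertex set $V(G)$, and its edge set $E(G)$ (possibly empty) is a set of unordered pairs of distinct vertices. A path is a finite graph with at least one edge whose vertices can be enumerated without repetition as $v_1,\dots,v_n$ so that $\{v_i,v_j\}$ is an edge iff $|i-j|=1$; it connects $v_1$ and $v_n$. For distinct $u,v\in V(G)$, $\mathfrak{P}_{u,v}$ is the set of paths in $G$ (subgraphs of $G$, not necessarily induced) connecting $u$ and $v$. $G$ is connected if any two distinct vertices are connected by a path in $G$. A weight on $G$ is a function $w:E(G)\to\mathbb{R}^+=[0,+\infty)$; it is strictly positive if $w(e)>0$ for every $e\in E(G)$. A pseudoultrametric on a set $X$ is a function $d:X\times X\to\mathbb{R}^+$ with $d(x,y)=d(y,x)$, $d(x,x)=0$ and $d(x,y)\le\max\{d(x,z),d(z,y)\}$ for all $x,y,z\in X$; it is an ultrametric if moreover $d(x,y)=0$ implies $x=y$. The weight $w$ is pseudoultrametrizable if there is a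 pseudoultrametric $d$ on $V(G)$ with $d(x,y)=w(\{x,y\})$ for every $\{x,y\}\in E(G)$. For connected $G$, the subdominant pseudoultrametric for $w$ (the pointwise greatest pseudoultrametric $\rho$ on $V(G)$ with $\rho(u,v)\le w(\{u,v\})$ for all $\{u,v\}\in E(G)$) is given by $\rho_w(x,x)=0$ and, for $x\ne y$, $\rho_w(x,y)=\inf_{P\in\mathfrak{P}_{x,y}}\max_{e\in E(P)}w(e)$. *)

theory Defs
  imports Complex_Main
begin

record 'a sgraph =
  verts :: "'a set"
  edges :: "'a set set"

definition simple_graph :: "'a sgraph \<Rightarrow> bool" where
  "simple_graph G \<longleftrightarrow> verts G \<noteq> {} \<and>
     (\<forall>e\<in>edges G. \<exists>u\<in>verts G. \<exists>v\<in>verts G. u \<noteq> v \<and> e = {u, v})"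

definition is_subgraph :: "'a sgraph \<Rightarrow> 'a sgraph \<Rightarrow> bool" where
  "is_subgraph H G \<longleftrightarrow> verts H \<subseteq> verts G \<and> edges H \<subseteq> edges G"

(* Finiteness of P is implied by verts P = set xs. *)
definition path_connecting :: "'a sgraph \<Rightarrow> 'a \<Rightarrow> 'a \<Rightarrow> bool" where
  "path_connecting P u v \<longleftrightarrow> simple_graph P \<and> edges P \<noteq> {} \<and>
     (\<exists>xs. distinct xs \<and> set xs = verts P \<and>
        (\<forall>i<length xs. \<forall>j<length xs.
           {xs ! i, xs ! j} \<in> edges P \<longleftrightarrow> \<bar>int i - int j\<bar> = 1) \<and>
        hd xs = u \<and> last xs = v)"

definition paths :: "'a sgraph \<Rightarrow> 'a \<Rightarrow> 'a \<Rightarrow> 'a sgraph set" where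
  "paths G u v = {P. is_subgraph P G \<and> path_connecting P u v}"

definition connected_graph :: "'a sgraph \<Rightarrow> bool" where
  "connected_graph G \<longleftrightarrow>
     (\<forall>u\<in>verts G. \<forall>v\<in>verts G. u \<noteq> v \<longrightarrow> paths G u v \<noteq> {})"

(* Weights are functions on all sets of vertices; only the values on edges G matter. *)
definition weight :: "'a sgraph \<Rightarrow> ('a set \<Rightarrow> real) \<Rightarrow> bool" where
  "weight G w \<longleftrightarrow> (\<forall>e\<in>edges G. 0 \<le> w e)"

definition strictly_positive :: "'a sgraph \<Rightarrow> ('a set \<Rightarrow> real) \<Rightarrow> bool" where
  "strictly_positive G w \<longleftrightarrow> (\<forall>e\<in>edges G. 0 < w e)"

definition pseudoultrametric_on :: "'a set \<Rightarrow> ('a \<Rightarrow> 'a \<Rightarrow> real) \<Rightarrow> bool" where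
  "pseudoultrametric_on X d \<longleftrightarrow>
     (\<forall>x\<in>X. \<forall>y\<in>X. 0 \<le> d x y \<and> d x y = d y x) \<and>
     (\<forall>x\<in>X. d x x = 0) \<and>
     (\<forall>x\<in>X. \<forall>y\<in>X. \<forall>z\<in>X. d x y \<le> max (d x z) (d z y))"

definition ultrametric_on :: "'a set \<Rightarrow> ('a \<Rightarrow> 'a \<Rightarrow> real) \<Rightarrow> bool" where
  "ultrametric_on X d \<longleftrightarrow> pseudoultrametric_on X d \<and>
     (\<forall>x\<in>X. \<forall>y\<in>X. d x y = 0 \<longrightarrow> x = y)"

definition pseudoultrametrizable :: "'a sgraph \<Rightarrow> ('a set \<Rightarrow> real) \<Rightarrow> bool" where
  "pseudoultrametrizable G w \<longleftrightarrow>
     (\<exists>d. pseudoultrametric_on (verts G) d \<and>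
        (\<forall>x\<in>verts G. \<forall>y\<in>verts G. {x, y} \<in> edges G \<longrightarrow> d x y = w {x, y}))"

(* The infimum is the real one, so it is meaningful only when paths G x y is nonempty
   and w is bounded below on edges G; see subdominant_greatest. *)
definition subdominant :: "'a sgraph \<Rightarrow> ('a set \<Rightarrow> real) \<Rightarrow> 'a \<Rightarrow> 'a \<Rightarrow> real" where
  "subdominant G w x y =
     (if x = y then 0 else (INF P\<in>paths G x y. Max (w ` edges P)))"


lemma path_edges:
  assumes "simple_graph P" "distinct xs" "set xs = verts P"
    and nth: "\<forall>i<length xs. \<forall>j<length xs. {xs ! i, xs ! j} \<in> edges P \<longleftrightarrow> \<bar>int i - int j\<bar> = 1"
  shows "edges P = {{xs ! i, xs ! Suc i} | i. Suc i < length xs}" (is "_ = ?R")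
proof
  show "?R \<subseteq> edges P" using nth by auto
  show "edges P \<subseteq> ?R"
  proof
    fix e assume e: "e \<in> edges P"
    then obtain u v where uv: "u \<in> verts P" "v \<in> verts P" "e = {u, v}"
      using assms(1) unfolding simple_graph_def by blast
    then obtain i j where ij: "i < length xs" "j < length xs" "u = xs ! i" "v = xs ! j"
      using assms(3) by (metis in_set_conv_nth)
    then have "\<bar>int i - int j\<bar> = 1" using nth e uv by blast
    then have "j = Suc i \<or> i = Suc j" by linarith
    then show "e \<in> ?R" using uv ij by (auto simp: insert_commute)
  qed
qed

lemma path_finite_edges:
  assumes "path_connecting P u v" shows "finite (edges P)"
proof -
  have "finite (verts P)"
    using assms unfolding path_connecting_def by (metis List.finite_set)
  moreover have "edges P \<subseteq> Pow (verts P)"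
    using assms unfolding path_connecting_def simple_graph_def by auto
  ultimately show ?thesis by (metis finite_Pow_iff finite_subset)
qed

lemma path_walk:
  assumes "path_connecting P u v"
  obtains xs where "xs \<noteq> []" "hd xs = u" "last xs = v" "set xs = verts P"
    "successively (\<lambda>a b. {a, b} \<in> edges P) xs"
proof -
  obtain xs where xs: "distinct xs" "set xs = verts P" "hd xs = u" "last xs = v"
     "\<forall>i<length xs. \<forall>j<length xs. {xs ! i, xs ! j} \<in> edges P \<longleftrightarrow> \<bar>int i - int j\<bar> = 1"
    and P: "simple_graph P"
    using assms unfolding path_connecting_def by blast
  have "xs \<noteq> []" using xs(2) P unfolding simple_graph_def by auto
  moreover have "successively (\<lambda>a b. {a, b} \<in> edges P) xs"
    unfolding successively_conv_nth using xs(5) by auto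
  ultimately show ?thesis using that xs by blast
qed

lemma walk_path:
  assumes "xs \<noteq> []" "hd xs = u" "last xs = v" "u \<noteq> v"
    and "successively (\<lambda>a b. {a, b} \<in> E) xs"
  shows "\<exists>P. path_connecting P u v \<and> edges P \<subseteq> E \<and> verts P \<subseteq> set xs"
  using assms
proof (induction "length xs" arbitrary: xs rule: less_induct)
  case less
  show ?case
  proof (cases "distinct xs")
    case False
    then obtain as bs cs y where d: "xs = as @ [y] @ bs @ [y] @ cs"
      using not_distinct_decomp by blast
    let ?ys = "as @ [y] @ cs"
    have "successively (\<lambda>a b. {a, b} \<in> E) ?ys"
      using less.prems(5) unfolding d
      by (auto simp: successively_append_iff successively_Cons)
    moreover have "hd ?ys = u" "last ?ys = v"
      using less.prems d by (auto simp: hd_append)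
    moreover have "length ?ys < length xs" by (simp add: d)
    ultimately obtain P where "path_connecting P u v" "edges P \<subseteq> E" "verts P \<subseteq> set ?ys"
      using less.hyps[of ?ys] less.prems(4) by auto
    then show ?thesis unfolding d by (intro exI[of _ P]) auto
  next
    case True
    define P where "P = \<lparr>verts = set xs, edges = {{xs ! i, xs ! Suc i} | i. Suc i < length xs}\<rparr>"
    have len: "Suc 0 < length xs"
      using less.prems(1-4) by (cases xs; cases "tl xs") auto
    have inj: "xs ! i = xs ! j \<longleftrightarrow> i = j" if "i < length xs" "j < length xs" for i j
      using True that nth_eq_iff_index_eq by blast
    have "simple_graph P"
      unfolding simple_graph_def
    proof (intro conjI ballI)
      show "verts P \<noteq> {}" using less.prems(1) by (simp add: P_def)
      fix e assume "e \<in> edges P"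
      then obtain i where i: "Suc i < length xs" "e = {xs ! i, xs ! Suc i}" by (auto simp: P_def)
      then show "\<exists>u\<in>verts P. \<exists>v\<in>verts P. u \<noteq> v \<and> e = {u, v}"
        by (intro bexI[of _ "xs ! i"] bexI[of _ "xs ! Suc i"]) (auto simp: P_def inj)
    qed
    moreover have "edges P \<noteq> {}" using len by (auto simp: P_def)
    moreover have "{xs ! i, xs ! j} \<in> edges P \<longleftrightarrow> \<bar>int i - int j\<bar> = 1"
      if ij: "i < length xs" "j < length xs" for i j
    proof
      assume "{xs ! i, xs ! j} \<in> edges P"
      then obtain k where k: "Suc k < length xs" "{xs ! i, xs ! j} = {xs ! k, xs ! Suc k}"
        by (auto simp: P_def)
      then have "i = k \<and> j = Suc k \<or> i = Suc k \<and> j = k"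
        using ij inj[of i k] inj[of j k] inj[of i "Suc k"] inj[of j "Suc k"]
        by (auto simp: doubleton_eq_iff)
      then show "\<bar>int i - int j\<bar> = 1" by auto
    next
      assume "\<bar>int i - int j\<bar> = 1"
      then have "j = Suc i \<or> i = Suc j" by linarith
      then show "{xs ! i, xs ! j} \<in> edges P"
        using ij by (auto simp: P_def insert_commute)
    qed
    moreover have "set xs = verts P" by (simp add: P_def)
    ultimately have "path_connecting P u v"
      unfolding path_connecting_def using True less.prems(2,3) by blast
    moreover have "edges P \<subseteq> E"
      using less.prems(5) by (auto simp: P_def successively_conv_nth)
    ultimately show ?thesis by (intro exI[of _ P]) (auto simp: P_def)
  qed
qed

lemma paths_sym: "paths G u v = paths G v u"
proof -
  have "path_connecting P v u" if P: "path_connecting P u v" for P :: "'a sgraph" and u v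
  proof -
    obtain xs where xs: "distinct xs" "set xs = verts P" "hd xs = u" "last xs = v"
       "\<forall>i<length xs. \<forall>j<length xs. {xs ! i, xs ! j} \<in> edges P \<longleftrightarrow> \<bar>int i - int j\<bar> = 1"
      and g: "simple_graph P" "edges P \<noteq> {}"
      using P unfolding path_connecting_def by blast
    have "xs \<noteq> []" using xs(2) g unfolding simple_graph_def by auto
    moreover have "{rev xs ! i, rev xs ! j} \<in> edges P \<longleftrightarrow> \<bar>int i - int j\<bar> = 1"
      if "i < length xs" "j < length xs" for i j
    proof -
      have "\<bar>int (length xs - Suc i) - int (length xs - Suc j)\<bar> = \<bar>int i - int j\<bar>"
        using that by (simp add: of_nat_diff)
      then show ?thesis using xs(5) that by (simp add: rev_nth)
    qed
    moreover have "distinct (rev xs)" "set (rev xs) = verts P" using xs(1,2) by simp_all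
    moreover have "hd (rev xs) = v" "last (rev xs) = u"
      using xs(3,4) by (simp_all add: hd_rev last_rev)
    ultimately show ?thesis
      unfolding path_connecting_def using g length_rev[of xs] by metis
  qed
  then show ?thesis unfolding paths_def by blast
qed

context
  fixes G :: "'a sgraph" and w :: "'a set \<Rightarrow> real"
  assumes G: "simple_graph G" "connected_graph G" and w: "weight G w"
begin

lemma path_max:
  assumes "P \<in> paths G x y"
  shows "finite (edges P)" "edges P \<noteq> {}" "0 \<le> Max (w ` edges P)"
proof -
  have p: "path_connecting P x y" "edges P \<subseteq> edges G"
    using assms by (auto simp: paths_def is_subgraph_def)
  show f: "finite (edges P)" using path_finite_edges p(1) .
  show n: "edges P \<noteq> {}" using p(1) by (simp add: path_connecting_def)
  have "\<forall>e\<in>edges P. 0 \<le> w e" using w p(2) by (auto simp: weight_def)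
  then show "0 \<le> Max (w ` edges P)" using f n by (simp add: Max_ge_iff) blast
qed

lemma bdd_path_max: "bdd_below ((\<lambda>P. Max (w ` edges P)) ` paths G x y)"
  using path_max by (intro bdd_belowI[of _ 0]) auto

lemma subdominant_nonneg:
  assumes "x \<in> verts G" "y \<in> verts G"
  shows "0 \<le> subdominant G w x y"
  using assms G(2) path_max
  by (auto simp: subdominant_def connected_graph_def intro!: cINF_greatest)

lemma subdominant_triangle:
  assumes v: "x \<in> verts G" "y \<in> verts G" "z \<in> verts G"
  shows "subdominant G w x y \<le> max (subdominant G w x z) (subdominant G w z y)"
proof (cases "x = y \<or> x = z \<or> z = y")
  case True
  have "subdominant G w a a = 0" for a by (simp add: subdominant_def)
  then show ?thesis using True subdominant_nonneg v by (auto simp: max_def)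
next
  case False
  let ?M = "\<lambda>P. Max (w ` edges P)"
  have key: "subdominant G w x y \<le> max (?M P) (?M Q)"
    if P: "P \<in> paths G x z" and Q: "Q \<in> paths G z y" for P Q
  proof -
    have "path_connecting P x z" "path_connecting Q z y"
      and sub: "is_subgraph P G" "is_subgraph Q G"
      using P Q by (auto simp: paths_def)
    then obtain xs ys where
      xs: "xs \<noteq> []" "hd xs = x" "last xs = z" "set xs = verts P"
        "successively (\<lambda>a b. {a, b} \<in> edges P) xs" and
      ys: "ys \<noteq> []" "hd ys = z" "last ys = y" "set ys = verts Q"
        "successively (\<lambda>a b. {a, b} \<in> edges Q) ys"
      using path_walk by metis
    obtain ys' where ys': "ys = z # ys'" using ys(1,2) by (cases ys) auto
    have ne: "ys' \<noteq> []" using ys(3) ys' False by auto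
    let ?E = "edges P \<union> edges Q"
    have "successively (\<lambda>a b. {a, b} \<in> ?E) xs" "successively (\<lambda>a b. {a, b} \<in> ?E) ys"
      using xs(5) ys(5) by (auto intro: successively_mono)
    then have "successively (\<lambda>a b. {a, b} \<in> ?E) (xs @ ys')"
      using ne xs(3) unfolding ys' by (auto simp: successively_append_iff successively_Cons)
    moreover have "hd (xs @ ys') = x" "last (xs @ ys') = y"
      using xs(1,2) ys(3) ys' ne by auto
    ultimately obtain R where R: "path_connecting R x y" "edges R \<subseteq> ?E" "verts R \<subseteq> set (xs @ ys')"
      using walk_path[of "xs @ ys'" x y ?E] xs(1) False by blast
    have "verts R \<subseteq> verts P \<union> verts Q" using R(3) xs(4) ys(4) ys' by auto
    then have RG: "R \<in> paths G x y"
      using R(1,2) sub unfolding paths_def is_subgraph_def by blast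
    have "subdominant G w x y \<le> ?M R"
      using False RG by (auto simp: subdominant_def intro: cINF_lower[OF bdd_path_max])
    also have "?M R \<le> max (?M P) (?M Q)"
    proof (rule Max.boundedI)
      fix a assume "a \<in> w ` edges R"
      then obtain e where "e \<in> ?E" "a = w e" using R(2) by auto
      then show "a \<le> max (?M P) (?M Q)"
        using path_max(1)[OF P] path_max(1)[OF Q] by (auto simp: le_max_iff_disj)
    qed (use path_max[OF RG] in auto)
    finally show ?thesis .
  qed
  have ne: "paths G x z \<noteq> {}" "paths G z y \<noteq> {}"
    using G(2) v False by (auto simp: connected_graph_def)
  show ?thesis
  proof (rule ccontr)
    assume "\<not> ?thesis"
    then have "(INF P\<in>paths G x z. ?M P) < subdominant G w x y"
       "(INF P\<in>paths G z y. ?M P) < subdominant G w x y"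
      using False by (auto simp: subdominant_def[of G w x z] subdominant_def[of G w z y])
    then obtain P Q where "P \<in> paths G x z" "?M P < subdominant G w x y"
        "Q \<in> paths G z y" "?M Q < subdominant G w x y"
      using ne bdd_path_max by (auto simp: cINF_less_iff)
    then show False using key[of P Q] by auto
  qed
qed

lemma subdominant_pseudoultrametric: "pseudoultrametric_on (verts G) (subdominant G w)"
proof -
  have "subdominant G w x y = subdominant G w y x" for x y
    by (simp add: subdominant_def paths_sym[of G x y])
  moreover have "subdominant G w x x = 0" for x by (simp add: subdominant_def)
  ultimately show ?thesis
    unfolding pseudoultrametric_on_def using subdominant_nonneg subdominant_triangle by blast
qed

lemma subdominant_le_weight:
  assumes e: "{x, y} \<in> edges G"
  shows "subdominant G w x y \<le> w {x, y}"
proof -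
  have xy: "x \<in> verts G" "y \<in> verts G" "x \<noteq> y"
    using G(1) e unfolding simple_graph_def by (auto simp: doubleton_eq_iff)
  have "successively (\<lambda>a b. {a, b} \<in> {{x, y}}) [x, y]" by simp
  then obtain P where P: "path_connecting P x y" "edges P \<subseteq> {{x, y}}" "verts P \<subseteq> set [x, y]"
    using walk_path[of "[x, y]" x y "{{x, y}}"] xy(3) by auto
  then have PG: "P \<in> paths G x y"
    using xy e by (auto simp: paths_def is_subgraph_def)
  have "edges P = {{x, y}}" using P(2) path_max(2)[OF PG] by auto
  then have "Max (w ` edges P) = w {x, y}" by simp
  moreover have "subdominant G w x y \<le> Max (w ` edges P)"
    using xy PG by (auto simp: subdominant_def intro: cINF_lower[OF bdd_path_max])
  ultimately show ?thesis by simp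
qed

lemma pseudoultrametric_le_subdominant:
  assumes d: "pseudoultrametric_on (verts G) d"
    and le: "\<And>u v. {u, v} \<in> edges G \<Longrightarrow> d u v \<le> w {u, v}"
    and xy: "x \<in> verts G" "y \<in> verts G"
  shows "d x y \<le> subdominant G w x y"
proof (cases "x = y")
  case True
  then show ?thesis using d xy by (auto simp: subdominant_def pseudoultrametric_on_def)
next
  case False
  have "d x y \<le> Max (w ` edges P)" if P: "P \<in> paths G x y" for P
  proof -
    let ?M = "Max (w ` edges P)"
    have sub: "verts P \<subseteq> verts G" "edges P \<subseteq> edges G"
      using P by (auto simp: paths_def is_subgraph_def)
    have walk: "d (hd xs) (last xs) \<le> ?M"
      if "xs \<noteq> []" "set xs \<subseteq> verts G" "successively (\<lambda>a b. {a, b} \<in> edges P) xs" for xs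
      using that
    proof (induction xs rule: induct_list012)
      case (2 a)
      then show ?case using d path_max(3)[OF P] by (auto simp: pseudoultrametric_on_def)
    next
      case (3 a b xs)
      have "d a b \<le> w {a, b}" using 3 sub le by auto
      also have "\<dots> \<le> ?M" using 3 path_max(1)[OF P] by auto
      finally have ab: "d a b \<le> ?M" .
      have "d b (last (b # xs)) \<le> ?M" using 3 by auto
      moreover have "last (b # xs) \<in> set (b # xs)" by (rule last_in_set) simp
      then have "d a (last (b # xs)) \<le> max (d a b) (d b (last (b # xs)))"
        using d 3(4) unfolding pseudoultrametric_on_def by (meson list.set_intros subset_iff)
      ultimately show ?case using ab by auto
    qed simp
    have "path_connecting P x y" using P by (simp add: paths_def)
    then obtain xs where "xs \<noteq> []" "hd xs = x" "last xs = y" "set xs = verts P"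
      "successively (\<lambda>a b. {a, b} \<in> edges P) xs"
      by (rule path_walk)
    then show ?thesis using walk[of xs] sub by auto
  qed
  then show ?thesis
    using False G(2) xy by (auto simp: subdominant_def connected_graph_def intro!: cINF_greatest)
qed

theorem subdominant_greatest:
  "pseudoultrametric_on (verts G) (subdominant G w) \<and>
   (\<forall>x y. {x, y} \<in> edges G \<longrightarrow> subdominant G w x y \<le> w {x, y}) \<and>
   (\<forall>d. pseudoultrametric_on (verts G) d \<and> (\<forall>u v. {u, v} \<in> edges G \<longrightarrow> d u v \<le> w {u, v}) \<longrightarrow>
      (\<forall>x\<in>verts G. \<forall>y\<in>verts G. d x y \<le> subdominant G w x y))"
  using subdominant_pseudoultrametric subdominant_le_weight pseudoultrametric_le_subdominant
  by blast

end

end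

theory Submission
  imports Defs
begin

text \<open>
  Both implications compare the edges of the graph with a sequence of paths between two fixed
  vertices whose largest edge weights tend to zero; such a sequence exists exactly when the
  subdominant pseudoultrametric fails to separate the two vertices.

  Suppose first that some weight \<open>w\<close> as in (i), realised by a pseudoultrametric \<open>d\<close>, has such a
  sequence \<open>F\<close>. By the strong triangle inequality, all vertices of \<open>F j\<close> are within the largest
  edge weight of \<open>F j\<close> from the common end point (\<open>pseudoultrametric_le_Max_on_path\<close>). A vertex
  that lies on infinitely many paths is therefore at distance zero from this end point. Two such
  vertices are at distance zero from each other, so by strict positivity they never form an edge,
  contrary to (ii).

  Conversely, suppose that \<open>F\<close> violates (ii). Label a vertex \<open>x\<close> by
  \<open>1 / (1 + n)\<close>, where \<open>n\<close> is the last index at which \<open>F\<close>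
  visits \<open>x\<close> (\<open>0\<close> if there is none), and by \<open>0\<close> if there
  are infinitely many visits (\<open>visit_label\<close>). Let the weight of an edge be the larger
  label of its end points. The violation of (ii) says precisely that every edge has an end point
  with nonzero label, so this weight is strictly positive. It is pseudoultrametrizable, because
  the larger label of two distinct points is always a pseudoultrametric
  (\<open>pseudoultrametric_max_label\<close>). All labels on \<open>F j\<close> are at most
  \<open>1 / (1 + j)\<close>, so the subdominant pseudoultrametric vanishes at the two end points.
\<close>

section \<open>Pseudoultrametrics along paths\<close>

lemma pseudoultrametric_le_on_walk:
  assumes "pseudoultrametric_on X d" "xs \<noteq> []" "set xs \<subseteq> X" "0 \<le> M"
    and "successively (\<lambda>a b. d a b \<le> M) xs" "y \<in> set xs"
  shows "d (hd xs) y \<le> M"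
  using assms(2-)
proof (induction xs rule: induct_list012)
  case (2 a)
  then show ?case using assms(1) by (auto simp: pseudoultrametric_on_def)
next
  case (3 a b xs)
  show ?case
  proof (cases "y = a")
    case True
    then show ?thesis using 3 assms(1) by (auto simp: pseudoultrametric_on_def)
  next
    case False
    then have "d b y \<le> M" "d a b \<le> M" using 3 by auto
    moreover have "d a y \<le> max (d a b) (d b y)"
      using assms(1) "3.prems" unfolding pseudoultrametric_on_def
      by (meson list.set_intros subset_iff)
    ultimately show ?thesis by simp
  qed
qed simp

text \<open>The strong triangle inequality turns a bound on single steps into the same bound on
  arbitrarily long walks, so a path does not get farther from its start than its longest edge.\<close>

lemma pseudoultrametric_le_Max_on_path:
  assumes "simple_graph G" "weight G w" "pseudoultrametric_on (verts G) d"
    and eq: "\<forall>x\<in>verts G. \<forall>y\<in>verts G. {x, y} \<in> edges G \<longrightarrow> d x y = w {x, y}"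
    and P: "P \<in> paths G u v" and y: "y \<in> verts P"
  shows "d u y \<le> Max (w ` edges P)"
proof -
  have p: "path_connecting P u v" and sub: "verts P \<subseteq> verts G" "edges P \<subseteq> edges G"
    using P by (auto simp: paths_def is_subgraph_def)
  have fin: "finite (edges P)" using path_finite_edges p .
  obtain e where e: "e \<in> edges P" using p by (auto simp: path_connecting_def)
  obtain xs where xs: "xs \<noteq> []" "hd xs = u" "set xs = verts P"
    "successively (\<lambda>a b. {a, b} \<in> edges P) xs"
    using path_walk[OF p] by metis
  have "0 \<le> w e" using e sub assms(2) by (auto simp: weight_def)
  also have "w e \<le> Max (w ` edges P)" using e fin by simp
  finally have "0 \<le> Max (w ` edges P)" .
  moreover have "successively (\<lambda>a b. d a b \<le> Max (w ` edges P)) xs"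
  proof (rule successively_mono[OF xs(4)])
    fix a b assume "a \<in> set xs" "b \<in> set xs" and ab: "{a, b} \<in> edges P"
    then have "d a b = w {a, b}" using eq sub xs(3) by blast
    also have "\<dots> \<le> Max (w ` edges P)" using ab fin by simp
    finally show "d a b \<le> Max (w ` edges P)" .
  qed
  ultimately show ?thesis
    using pseudoultrametric_le_on_walk[OF assms(3) xs(1)] xs(2,3) sub(1) y by metis
qed

section \<open>Vanishing of the subdominant pseudoultrametric\<close>

lemma subdominant_zero_obtain_path:
  assumes "simple_graph G" "connected_graph G" "weight G w"
    and "u \<in> verts G" "v \<in> verts G" "u \<noteq> v"
    and "subdominant G w u v = 0" "0 < \<epsilon>"
  shows "\<exists>P\<in>paths G u v. Max (w ` edges P) < \<epsilon>"
proof -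
  have "paths G u v \<noteq> {}" using assms(2,4-6) by (simp add: connected_graph_def)
  moreover have "(INF P\<in>paths G u v. Max (w ` edges P)) < \<epsilon>"
    using assms(6-8) by (simp add: subdominant_def)
  ultimately show ?thesis
    using bdd_path_max[OF assms(1-3)] by (simp add: cINF_less_iff)
qed

lemma subdominant_le_Max_path:
  assumes "simple_graph G" "connected_graph G" "weight G w"
    and "u \<noteq> v" "P \<in> paths G u v"
  shows "subdominant G w u v \<le> Max (w ` edges P)"
  using assms(4,5) by (auto simp: subdominant_def intro: cINF_lower[OF bdd_path_max[OF assms(1-3)]])

text \<open>A vertex that lies on paths with arbitrarily small largest edge is at distance zero from
  their common end point. If both ends of an edge are like this, that edge has weight zero.\<close>

lemma subdominant_separates_if_recurrent_edge:
  assumes G: "simple_graph G" "connected_graph G"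
    and w: "weight G w" "strictly_positive G w" "pseudoultrametrizable G w"
    and uv: "u \<in> verts G" "v \<in> verts G" "u \<noteq> v"
    and recurrent: "\<And>F :: nat \<Rightarrow> 'a sgraph. \<forall>j\<ge>1. F j \<in> paths G u v \<Longrightarrow>
      \<exists>a b. {a, b} \<in> edges G \<and> (\<forall>i>0. (\<exists>j>i. a \<in> verts (F j)) \<and> (\<exists>j>i. b \<in> verts (F j)))"
  shows "subdominant G w u v \<noteq> 0"
proof
  assume "subdominant G w u v = 0"
  then have "\<exists>P\<in>paths G u v. Max (w ` edges P) < 1 / real (Suc j)" for j
    by (intro subdominant_zero_obtain_path[OF G w(1) uv]) auto
  then obtain F where F: "\<And>j. F j \<in> paths G u v" "\<And>j. Max (w ` edges (F j)) < 1 / real (Suc j)"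
    by metis
  obtain d where d: "pseudoultrametric_on (verts G) d"
    and eq: "\<forall>x\<in>verts G. \<forall>y\<in>verts G. {x, y} \<in> edges G \<longrightarrow> d x y = w {x, y}"
    using w(3) unfolding pseudoultrametrizable_def by blast
  obtain a b where e: "{a, b} \<in> edges G"
    and inf: "\<And>i. i > 0 \<Longrightarrow> (\<exists>j>i. a \<in> verts (F j)) \<and> (\<exists>j>i. b \<in> verts (F j))"
    using recurrent F(1) by blast
  have ab: "a \<in> verts G" "b \<in> verts G"
    using G(1) e unfolding simple_graph_def by (auto simp: doubleton_eq_iff)
  have "d a b > 0" using w(2) e eq ab by (auto simp: strictly_positive_def)
  then obtain i where i: "1 / real (Suc i) < d a b"
    using reals_Archimedean by (auto simp: inverse_eq_divide)
  have near: "d u x < d a b" if x: "\<exists>j>Suc i. x \<in> verts (F j)" for x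
  proof -
    obtain j where j: "j > Suc i" "x \<in> verts (F j)" using x by blast
    have "d u x \<le> Max (w ` edges (F j))"
      by (rule pseudoultrametric_le_Max_on_path[OF G(1) w(1) d eq F(1) j(2)])
    also have "\<dots> < 1 / real (Suc j)" by (rule F(2))
    also have "\<dots> \<le> 1 / real (Suc i)" using j(1) by (simp add: frac_le)
    finally show ?thesis using i by simp
  qed
  have "d a b \<le> max (d a u) (d u b)" "d a u = d u a"
    using d ab uv(1) unfolding pseudoultrametric_on_def by blast+
  then show False using near[of a] near[of b] inf[of "Suc i"] by auto
qed

section \<open>Weights that degenerate along a sequence of paths\<close>

lemma pseudoultrametric_max_label:
  fixes f :: "'a \<Rightarrow> real"
  assumes "\<And>x. 0 \<le> f x"
  shows "pseudoultrametric_on X (\<lambda>x y. if x = y then 0 else max (f x) (f y))"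
  using assms by (auto simp: pseudoultrametric_on_def le_max_iff_disj)

lemma pseudoultrametrizable_max_label:
  fixes f :: "'a \<Rightarrow> real"
  assumes "simple_graph G" "\<And>x. 0 \<le> f x"
  shows "pseudoultrametrizable G (\<lambda>e. Max (f ` e))"
  unfolding pseudoultrametrizable_def
proof (intro exI conjI ballI impI)
  show "pseudoultrametric_on (verts G) (\<lambda>x y. if x = y then 0 else max (f x) (f y))"
    using assms(2) by (rule pseudoultrametric_max_label)
  fix x y assume "{x, y} \<in> edges G"
  then have "x \<noteq> y"
    using assms(1) unfolding simple_graph_def by (auto simp: doubleton_eq_iff)
  then show "(if x = y then 0 else max (f x) (f y)) = Max (f ` {x, y})" by simp
qed

text \<open>Positive at \<open>x\<close> exactly when only finitely many \<open>A j\<close> contain \<open>x\<close>: the reciprocal of one plus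
  the last such index \<open>j\<close>, which is taken to be \<open>0\<close> if there is none.\<close>

definition visit_label :: "(nat \<Rightarrow> 'a set) \<Rightarrow> 'a \<Rightarrow> real" where
  "visit_label A x =
     (if \<exists>i. \<forall>j>i. x \<notin> A j then 1 / real (Suc (LEAST i. \<forall>j>i. x \<notin> A j)) else 0)"

lemma visit_label_nonneg: "0 \<le> visit_label A x"
  by (simp add: visit_label_def)

lemma visit_label_pos: "\<forall>j>i. x \<notin> A j \<Longrightarrow> 0 < visit_label A x"
  by (auto simp: visit_label_def)

lemma visit_label_le:
  assumes "x \<in> A j"
  shows "visit_label A x \<le> 1 / real (Suc j)"
proof (cases "\<exists>i. \<forall>j>i. x \<notin> A j")
  case True
  then have "\<forall>j > (LEAST i. \<forall>j>i. x \<notin> A j). x \<notin> A j" by (rule LeastI_ex)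
  then have "j \<le> (LEAST i. \<forall>j>i. x \<notin> A j)" using assms not_less by blast
  then show ?thesis using True by (simp add: visit_label_def frac_le)
next
  case False
  then have "visit_label A x = 0" unfolding visit_label_def by (rule if_not_P)
  then show ?thesis by simp
qed

text \<open>If every edge has an end point that the sequence \<open>F\<close> eventually avoids, then labelling
  vertices by their last visit gives a strictly positive weight that tends to zero along \<open>F\<close>.\<close>

lemma degenerate_weight_if_no_recurrent_edge:
  fixes F :: "nat \<Rightarrow> 'a sgraph"
  assumes G: "simple_graph G" "connected_graph G" and uv: "u \<noteq> v"
    and F: "\<forall>j\<ge>1. F j \<in> paths G u v"
    and transient: "\<And>a b. {a, b} \<in> edges G \<Longrightarrow>
      (\<exists>i. \<forall>j>i. a \<notin> verts (F j)) \<or> (\<exists>i. \<forall>j>i. b \<notin> verts (F j))"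
  shows "\<exists>w. weight G w \<and> strictly_positive G w \<and> pseudoultrametrizable G w \<and>
    subdominant G w u v \<le> 0"
proof -
  define f where "f = visit_label (\<lambda>j. verts (F j))"
  define w where "w = (\<lambda>e. Max (f ` e))"
  have pos: "strictly_positive G w"
    unfolding strictly_positive_def
  proof
    fix e assume e: "e \<in> edges G"
    then obtain a b where ab: "e = {a, b}" using G(1) unfolding simple_graph_def by blast
    then have "0 < f a \<or> 0 < f b"
      using transient e visit_label_pos[of _ _ "\<lambda>j. verts (F j)"] unfolding f_def by blast
    then show "0 < w e" by (auto simp: w_def ab)
  qed
  then have wt: "weight G w" by (auto simp: weight_def strictly_positive_def intro: less_imp_le)
  have "pseudoultrametrizable G w"
    unfolding w_def using G(1)
    by (rule pseudoultrametrizable_max_label) (simp add: f_def visit_label_nonneg)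
  moreover have "subdominant G w u v \<le> 0"
  proof (rule ccontr)
    assume "\<not> subdominant G w u v \<le> 0"
    then obtain j where j: "1 / real (Suc j) < subdominant G w u v"
      using reals_Archimedean[of "subdominant G w u v"] unfolding inverse_eq_divide not_le by blast
    \<comment> \<open>Only the positive indices of \<open>F\<close> carry paths.\<close>
    let ?P = "F (Suc j)"
    have P: "?P \<in> paths G u v" using F by simp
    then have p: "simple_graph ?P" "path_connecting ?P u v" "edges ?P \<noteq> {}"
      by (auto simp: paths_def path_connecting_def)
    have "w e \<le> 1 / real (Suc (Suc j))" if e: "e \<in> edges ?P" for e
    proof -
      obtain a b where ab: "a \<in> verts ?P" "b \<in> verts ?P" "e = {a, b}"
        using p(1) e unfolding simple_graph_def by blast
      have "f x \<le> 1 / real (Suc (Suc j))" if "x \<in> verts ?P" for x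
        using that visit_label_le[of x "\<lambda>j. verts (F j)" "Suc j"] by (simp add: f_def)
      then show ?thesis using ab by (simp add: w_def)
    qed
    then have "Max (w ` edges ?P) \<le> 1 / real (Suc (Suc j))"
      using p(3) path_finite_edges[OF p(2)] by (simp add: Max_le_iff)
    also have "\<dots> \<le> 1 / real (Suc j)" by (simp add: frac_le)
    finally show False
      using subdominant_le_Max_path[OF G wt uv P] j by simp
  qed
  ultimately show ?thesis using pos wt by blast
qed

section \<open>The equivalence\<close>

lemma mem_tail_Union_iff:
  fixes F :: "nat \<Rightarrow> 'a sgraph"
  shows "x \<in> (\<Union>k\<in>{1..}. verts (F (i + k))) \<longleftrightarrow> (\<exists>j>i. x \<in> verts (F j))"
proof
  assume "\<exists>j>i. x \<in> verts (F j)"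
  then obtain j where "j > i" "x \<in> verts (F j)" by blast
  then show "x \<in> (\<Union>k\<in>{1..}. verts (F (i + k)))" by (intro UN_I[of "j - i"]) auto
next
  assume "x \<in> (\<Union>k\<in>{1..}. verts (F (i + k)))"
  then obtain k where "k \<ge> 1" "x \<in> verts (F (i + k))" by auto
  then show "\<exists>j>i. x \<in> verts (F j)" by (intro exI[of _ "i + k"]) auto
qed

theorem theorem4p4:
  fixes G :: "'a sgraph"
  assumes "simple_graph G" and "connected_graph G" and "edges G \<noteq> {}"
  shows "(\<forall>w. weight G w \<and> strictly_positive G w \<and> pseudoultrametrizable G w \<longrightarrow>
            ultrametric_on (verts G) (subdominant G w))
         \<longleftrightarrow>
         (\<forall>us\<in>verts G. \<forall>vs\<in>verts G. us \<noteq> vs \<longrightarrow>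
            (\<forall>F :: nat \<Rightarrow> 'a sgraph. (\<forall>j\<ge>1. F j \<in> paths G us vs) \<longrightarrow>
               (\<exists>u0 v0. {u0, v0} \<in> edges G \<and>
                  (\<forall>i>0. u0 \<in> (\<Union>k\<in>{1..}. verts (F (i + k))) \<and>
                         v0 \<in> (\<Union>k\<in>{1..}. verts (F (i + k)))))))"
    (is "?ultra \<longleftrightarrow> ?recurrent")
proof
  assume ultra: ?ultra
  show ?recurrent
    unfolding mem_tail_Union_iff
  proof (intro ballI impI allI, rule ccontr)
    fix u v and F :: "nat \<Rightarrow> 'a sgraph"
    assume uv: "u \<in> verts G" "v \<in> verts G" "u \<noteq> v" and F: "\<forall>j\<ge>1. F j \<in> paths G u v"
      and no: "\<nexists>a b. {a, b} \<in> edges G \<and>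
        (\<forall>i>0. (\<exists>j>i. a \<in> verts (F j)) \<and> (\<exists>j>i. b \<in> verts (F j)))"
    have "(\<exists>i. \<forall>j>i. a \<notin> verts (F j)) \<or> (\<exists>i. \<forall>j>i. b \<notin> verts (F j))"
      if "{a, b} \<in> edges G" for a b
      using no that by blast
    then obtain w where w: "weight G w" "strictly_positive G w" "pseudoultrametrizable G w"
      and le: "subdominant G w u v \<le> 0"
      using degenerate_weight_if_no_recurrent_edge[OF assms(1,2) uv(3) F] by blast
    have "subdominant G w u v = 0"
      using le subdominant_nonneg[OF assms(1,2) w(1) uv(1,2)] by simp
    then show False using ultra w uv unfolding ultrametric_on_def by blast
  qed
next
  assume ?recurrent
  then have recurrent: "\<exists>a b. {a, b} \<in> edges G \<and>
      (\<forall>i>0. (\<exists>j>i. a \<in> verts (F j)) \<and> (\<exists>j>i. b \<in> verts (F j)))"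
    if "u \<in> verts G" "v \<in> verts G" "u \<noteq> v" "\<forall>j\<ge>1. F j \<in> paths G u v"
    for u v and F :: "nat \<Rightarrow> 'a sgraph"
    using that unfolding mem_tail_Union_iff by simp
  show ?ultra
  proof (intro allI impI, elim conjE)
    fix w assume w: "weight G w" "strictly_positive G w" "pseudoultrametrizable G w"
    have "subdominant G w u v \<noteq> 0" if "u \<in> verts G" "v \<in> verts G" "u \<noteq> v" for u v
      using subdominant_separates_if_recurrent_edge[OF assms(1,2) w that recurrent[OF that]] .
    then show "ultrametric_on (verts G) (subdominant G w)"
      using subdominant_pseudoultrametric[OF assms(1,2) w(1)]
      unfolding ultrametric_on_def by blast
  qed
qed

end
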